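(* Let $k$ be a fixed positive integer. For $n\ge k$ let $\pi$ be chosen uniformly at random from the set of permutations $\pi\in S_n$ satisfying $\pi(i)\ge i-1$ for all $i\in\{2,\dots,n\}$, and let $C_{n,k}$ be the number of $k$-cycles of $\pi$. Put $$\mu_{n,k}=\frac{n-k+3}{2^{k+1}},\qquad \sigma_{n,k}^2=\frac{(2^{k+1}-2k+3)\,n+3k(k-4)+(3-k)2^{k+1}+5}{4^{k+1}}.$$ Then for every $t\in\mathbb{R}$, as $n\to\infty$, $$P\left(\frac{C_{n,k}-\mu_{n,k}}{\sigma_{n,k}}<t\right)\longrightarrow \frac{1}{\sqrt{2\pi}}\int_{-\infty}^t e^{-x^2/2}\,dx .$$
   Context: $S_n$ is the symmetric group on $\{1,\dots,n\}$. A $k$-cycle of a permutation is a cycle of length $k$ in its disjoint cycle decomposition, with fixed points counted as $1$-cycles. $\sigma_{n,k}$ denotes the positive square root of $\sigma_{n,k}^2$, which is positive for all sufficiently large $n$. In the limiting integral the constant $\pi$ is the usual number $3.14\ldots$. *)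

theory Defs
  imports "HOL-Probability.Probability" "HOL-Combinatorics.Combinatorics"
begin

definition restricted_perms :: "nat \<Rightarrow> (nat \<Rightarrow> nat) set" where
  "restricted_perms n = {p. p permutes {1..n} \<and> (\<forall>i\<in>{2..n}. p i \<ge> i - 1)}"

text \<open>The two facts under which \<^const>\<open>pmf_of_set\<close> is the uniform distribution.\<close>

lemma finite_restricted_perms: "finite (restricted_perms n)"
  by (rule finite_subset[OF _ finite_permutations[of "{1..n}"]])
     (auto simp: restricted_perms_def)

lemma restricted_perms_nonempty: "restricted_perms n \<noteq> {}"
proof -
  have "id \<in> restricted_perms n"
    by (simp add: restricted_perms_def permutes_id)
  then show ?thesis by blast
qed

text \<open>A cycle of \<open>p\<close> is identified with its support; the fixed points of \<open>p\<close> in \<open>{1..n}\<close>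
  are the cycles with \<open>k = 1\<close>.\<close>

definition num_cycles :: "nat \<Rightarrow> nat \<Rightarrow> (nat \<Rightarrow> nat) \<Rightarrow> nat" where
  "num_cycles n k p = card {C. C \<subseteq> {1..n} \<and> cyclic_on p C \<and> card C = k}"

definition mu_cyc :: "nat \<Rightarrow> nat \<Rightarrow> real" where
  "mu_cyc n k = (real n - real k + 3) / 2 ^ (k + 1)"

definition sigma_cyc_sq :: "nat \<Rightarrow> nat \<Rightarrow> real" where
  "sigma_cyc_sq n k =
     ((2 ^ (k + 1) - 2 * real k + 3) * real n + 3 * real k * (real k - 4)
       + (3 - real k) * 2 ^ (k + 1) + 5) / 4 ^ (k + 1)"

text \<open>For the finitely many \<open>n\<close> with \<open>sigma_cyc_sq n k \<le> 0\<close> this is a meaningless value; it does not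
  affect limits in \<open>n\<close>.\<close>

definition sigma_cyc :: "nat \<Rightarrow> nat \<Rightarrow> real" where
  "sigma_cyc n k = sqrt (sigma_cyc_sq n k)"

end

theory Submission
  imports Defs "HOL-Real_Asymp.Real_Asymp"
begin

text \<open>A permutation with \<open>p i \<ge> i - 1\<close> is a direct sum of descending cycles on consecutive intervals:
  the interval that contains \<open>n\<close> is forced once the preimage of \<open>n\<close> is known
  (\<open>restricted_perm_eq_append_cycle\<close>). Restricted permutations thus correspond to compositions of
  \<open>n\<close>, and \<open>k\<close>-cycles to parts equal to \<open>k\<close>. Splitting off the last part shows that there are
  \<open>2\<^sup>n\<^sup>-\<^sup>1\<close> of them, and that the probability generating function \<open>f n\<close> of the number of
  \<open>k\<close>-cycles satisfies, with \<open>a = 2\<^sup>-\<^sup>k\<^sup>-\<^sup>1\<close>,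
  \<open>f n - f (n - 1) = (u - 1) (2 a f (n - k) - a f (n - k - 1))\<close> (\<open>norm_gf_rec\<close>).

  For \<open>u\<close> near \<open>1\<close> the characteristic equation of this recurrence has a dominant root near \<open>1\<close>.
  At \<open>u = exp z\<close> the function \<open>exp (a z + b z\<^sup>2 / 2)\<close> satisfies that equation up to \<open>o(z\<^sup>2)\<close>,
  where \<open>b\<close> is the coefficient of \<open>n\<close> in the variance (\<open>char_defect_small\<close>). This accuracy is
  enough for \<open>z\<close> of order \<open>1 / sqrt n\<close>: after division by the \<open>n\<close>-th power of the approximate
  root, the sequence \<open>f\<close> has increments that are small multiples of its own recent increments, plus
  an error that sums to \<open>n o(1 / n)\<close>. So it stays near its initial value \<open>1\<close>
  (\<open>small_increments_recurrence\<close>, \<open>norm_gf_asymptotics\<close>).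

  Setting \<open>z = \<i> t / \<sigma>\<close> gives the characteristic function of the standardized number of cycles,
  which therefore tends to \<open>exp (- t\<^sup>2 / 2)\<close>, and Levy's continuity theorem concludes.\<close>

section \<open>Restricted permutations as sequences of intervals\<close>

text \<open>A permutation \<open>q\<close> of \<open>{1..i}\<close> is extended by the cycle \<open>n \<mapsto> n - 1 \<mapsto> \<dots> \<mapsto> i + 1 \<mapsto> n\<close>. This
  is the only cycle with support \<open>{i + 1..n}\<close> that respects the restriction, since such a cycle
  may descend only in steps of one.\<close>
definition append_cycle :: "nat \<Rightarrow> nat \<Rightarrow> (nat \<Rightarrow> nat) \<Rightarrow> nat \<Rightarrow> nat" where
  "append_cycle i n q =
     (\<lambda>x. if x = Suc i then n else if Suc i < x \<and> x \<le> n then x - 1 else q x)"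

lemma restricted_perms_permutes: "p \<in> restricted_perms n \<Longrightarrow> p permutes {1..n}"
  by (simp add: restricted_perms_def)

lemma append_cycle_in_restricted_perms:
  assumes "i < n" "q \<in> restricted_perms i"
  shows "append_cycle i n q \<in> restricted_perms n"
proof -
  have q: "q permutes {1..i}" and ge: "\<And>x. x \<in> {2..i} \<Longrightarrow> q x \<ge> x - 1"
    using assms(2) by (auto simp: restricted_perms_def)
  have in_i: "q x \<in> {1..i}" if "x \<in> {1..i}" for x
    using permutes_in_image[OF q] that by blast
  have "append_cycle i n q permutes {1..n}"
  proof (rule inj_imp_permutes)
    show "inj_on (append_cycle i n q) {1..n}"
    proof (rule inj_onI)
      fix x y assume xy: "x \<in> {1..n}" "y \<in> {1..n}"
        and eq: "append_cycle i n q x = append_cycle i n q y"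
      have "q x = q y \<longleftrightarrow> x = y" using permutes_inj[OF q] by (auto simp: inj_def)
      moreover have "x \<le> i \<Longrightarrow> q x \<le> i" "y \<le> i \<Longrightarrow> q y \<le> i" using in_i[of x] in_i[of y] xy by auto
      ultimately show "x = y" using xy eq assms(1) unfolding append_cycle_def
        by (auto split: if_splits)
    qed
    show "append_cycle i n q x \<in> {1..n}" if "x \<in> {1..n}" for x
      using that in_i[of x] assms(1) by (auto simp: append_cycle_def)
    show "append_cycle i n q x = x" if "x \<notin> {1..n}" for x
      using that permutes_not_in[OF q, of x] assms(1) by (auto simp: append_cycle_def)
  qed simp
  moreover have "append_cycle i n q x \<ge> x - 1" if "x \<in> {2..n}" for x
    using that ge[of x] assms(1) by (auto simp: append_cycle_def)
  ultimately show ?thesis by (auto simp: restricted_perms_def)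
qed

text \<open>Both data can be read off: \<open>i + 1\<close> is the preimage of \<open>n\<close>, and \<open>q\<close> is what remains
  below \<open>i + 1\<close>.\<close>
lemma append_cycle_inj:
  assumes i: "i < n" "q \<in> restricted_perms i" and j: "j < n" "r \<in> restricted_perms j"
    and eq: "append_cycle i n q = append_cycle j n r"
  shows "i = j \<and> q = r"
proof -
  let ?p = "append_cycle i n q"
  have "?p (Suc i) = ?p (Suc j)"
    by (subst (2) eq) (simp add: append_cycle_def)
  moreover have "inj ?p"
    using append_cycle_in_restricted_perms[OF i] restricted_perms_permutes permutes_inj by blast
  ultimately have ij: "i = j" by (auto simp: inj_def)
  have "q x = r x" for x
  proof (cases "x \<le> i")
    case True
    then show ?thesis using fun_cong[OF eq, of x] ij by (simp add: append_cycle_def)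
  next
    case False
    then show ?thesis
      using permutes_not_in[OF restricted_perms_permutes[OF i(2)], of x]
        permutes_not_in[OF restricted_perms_permutes[OF j(2)], of x] ij by simp
  qed
  with ij show ?thesis by auto
qed

text \<open>Let \<open>m\<close> be the preimage of \<open>n\<close>. Going down from \<open>x = n\<close> to \<open>x = m + 1\<close>, every value \<open>\<ge> x\<close>
  is already taken, by \<open>m\<close> or by a position above \<open>x\<close>. So \<open>x\<close> must go to \<open>x - 1\<close>, the least
  value that the restriction allows. Hence \<open>{m..n}\<close> is a cycle that splits off, and the rest is a
  restricted permutation of \<open>{1..m - 1}\<close>.\<close>
lemma restricted_perm_eq_append_cycle:
  assumes p: "p \<in> restricted_perms n" and "n \<ge> 1"
  obtains i q where "i < n" "q \<in> restricted_perms i" "p = append_cycle i n q"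
proof -
  have perm: "p permutes {1..n}" and ge: "\<And>x. x \<in> {2..n} \<Longrightarrow> p x \<ge> x - 1"
    using p by (auto simp: restricted_perms_def)
  have inj: "p x = p y \<longleftrightarrow> x = y" for x y
    using permutes_inj[OF perm] by (auto simp: inj_def)
  have img: "p x \<in> {1..n} \<longleftrightarrow> x \<in> {1..n}" for x
    using permutes_in_image[OF perm] by blast
  obtain m where m: "p m = n" using permutes_surj[OF perm] by (metis surjD)
  have m_in: "m \<in> {1..n}" using img[of m] m \<open>n \<ge> 1\<close> by auto
  have shift: "p x = x - 1" if "m < x" "x \<le> n" for x
    using that
  proof (induction "n - x" arbitrary: x rule: less_induct)
    case less
    have "p x \<noteq> y" if "x \<le> y" "y \<le> n" for y
    proof (cases "y = n")
      case True
      then show ?thesis using inj[of x m] m less.prems by auto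
    next
      case False
      then have "p (Suc y) = y" using less.hyps[of "Suc y"] less.prems that by auto
      then show ?thesis using inj[of x "Suc y"] that by auto
    qed
    moreover have "p x \<le> n" using img[of x] less.prems by auto
    ultimately have "p x < x" by (metis not_le_imp_less)
    moreover have "p x \<ge> x - 1" using ge[of x] less.prems m_in by auto
    ultimately show ?case by linarith
  qed
  define i where "i = m - 1"
  define q where "q = (\<lambda>x. if x \<le> i then p x else x)"
  have mi: "m = Suc i" using m_in by (auto simp: i_def)
  have small: "p x \<in> {1..i}" if "x \<in> {1..i}" for x
  proof -
    have "p x \<noteq> y" if "y \<in> {Suc i..n}" for y
    proof (cases "y = n")
      case True
      then show ?thesis using inj[of x m] m \<open>x \<in> {1..i}\<close> mi by auto
    next
      case False
      then have "p (Suc y) = y" using shift[of "Suc y"] that mi by auto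
      then show ?thesis using inj[of x "Suc y"] that \<open>x \<in> {1..i}\<close> by auto
    qed
    moreover have "p x \<in> {1..n}" using img[of x] that mi m_in by auto
    ultimately show ?thesis by (metis atLeastAtMost_iff not_less_eq_eq)
  qed
  have p0: "p 0 = 0" using permutes_not_in[OF perm, of 0] by simp
  have "q permutes {1..i}"
  proof (rule inj_imp_permutes)
    show "inj_on q {1..i}" by (auto simp: inj_on_def q_def inj)
    show "q x \<in> {1..i}" if "x \<in> {1..i}" for x using small[OF that] that by (simp add: q_def)
    show "q x = x" if "x \<notin> {1..i}" for x using that p0 by (cases "x = 0") (auto simp: q_def)
  qed simp
  then have "q \<in> restricted_perms i"
    using ge mi m_in by (auto simp: restricted_perms_def q_def)
  moreover have "p = append_cycle i n q"
  proof
    fix x show "p x = append_cycle i n q x"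
      using m shift[of x] mi permutes_not_in[OF perm, of x] by (auto simp: append_cycle_def q_def)
  qed
  moreover have "i < n" using mi m_in by auto
  ultimately show ?thesis using that by blast
qed

text \<open>The orbit of \<open>n\<close> is the appended interval; a cycle that avoids it lies in \<open>{1..i}\<close>, where the
  two permutations agree.\<close>
lemma num_cycles_append_cycle:
  assumes "i < n" "q \<in> restricted_perms i" "k \<ge> 1"
  shows "num_cycles n k (append_cycle i n q) = num_cycles i k q + (if n - i = k then 1 else 0)"
proof -
  let ?p = "append_cycle i n q"
  have perm: "?p permutes {1..n}"
    using append_cycle_in_restricted_perms[OF assms(1,2)] by (rule restricted_perms_permutes)
  have cyc_n: "cyclic_on ?p (orbit ?p n)"
    using perm by (rule cyclic_on_orbit) simp
  have n_in: "n \<in> orbit ?p n"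
    using perm by (intro permutation_self_in_orbit) (auto simp: permutation_permutes)
  have orb: "orbit ?p n = {Suc i..n}"
  proof (intro equalityI subsetI)
    fix x assume "x \<in> orbit ?p n"
    then show "x \<in> {Suc i..n}"
      by induction (use assms(1) in \<open>auto simp: append_cycle_def\<close>)
  next
    fix x assume "x \<in> {Suc i..n}"
    then have "Suc i \<le> x" "x \<le> n" by auto
    from this(2,1) show "x \<in> orbit ?p n"
    proof (induction rule: inc_induct)
      case base
      then show ?case using n_in by simp
    next
      case (step y)
      then have "?p (Suc y) \<in> orbit ?p n" by (intro orbit.step) auto
      then show ?case using step by (simp add: append_cycle_def)
    qed
  qed
  have agree: "cyclic_on ?p C \<longleftrightarrow> cyclic_on q C" if "C \<subseteq> {1..i}" for C
    using that by (intro cyclic_cong) (auto simp: append_cycle_def)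
  have split: "C \<subseteq> {1..n} \<and> cyclic_on ?p C \<longleftrightarrow> C \<subseteq> {1..i} \<and> cyclic_on q C \<or> C = {Suc i..n}" for C
  proof (cases "C \<subseteq> {1..i}")
    case True
    moreover have "{1..i} \<subseteq> {1..n}" using assms(1) by auto
    moreover have "C \<noteq> {Suc i..n}" using True assms(1) by auto
    ultimately show ?thesis using agree[OF True] by blast
  next
    case False
    have "C = {Suc i..n}" if C: "C \<subseteq> {1..n}" "cyclic_on ?p C"
    proof -
      from False C(1) obtain x where x: "x \<in> C" "x \<in> {Suc i..n}" by fastforce
      have "C = orbit ?p x" using orbit_cyclic_eq3[OF C(2) x(1)] by simp
      also have "\<dots> = orbit ?p n" using orbit_cyclic_eq3[OF cyc_n, of x] x(2) orb by simp
      finally show ?thesis using orb by simp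
    qed
    moreover have "{Suc i..n} \<subseteq> {1..n}" by auto
    moreover have "cyclic_on ?p {Suc i..n}" using cyc_n orb by simp
    ultimately show ?thesis using False by blast
  qed
  define A where "A = {C. C \<subseteq> {1..i} \<and> cyclic_on q C \<and> card C = k}"
  have "{C. C \<subseteq> {1..n} \<and> cyclic_on ?p C \<and> card C = k}
      = A \<union> (if n - i = k then {{Suc i..n}} else {})"
    unfolding A_def conj_assoc[symmetric] split by auto
  moreover have "{Suc i..n} \<notin> A" using assms(1) by (auto simp: A_def)
  moreover have "finite A" by (rule finite_subset[of _ "Pow {1..i}"]) (auto simp: A_def)
  ultimately show ?thesis
    unfolding num_cycles_def A_def[symmetric] by simp
qed

section \<open>The recurrence for the generating polynomial\<close>

definition cycle_gf :: "nat \<Rightarrow> nat \<Rightarrow> complex \<Rightarrow> complex" where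
  "cycle_gf k n u = (\<Sum>p\<in>restricted_perms n. u ^ num_cycles n k p)"

lemma cycle_gf_decompose:
  assumes "n \<ge> 1" "k \<ge> 1"
  shows "cycle_gf k n u = (\<Sum>i<n. (if n - i = k then u else 1) * cycle_gf k i u)"
proof -
  have bij: "bij_betw (\<lambda>(i, q). append_cycle i n q) (SIGMA i:{..<n}. restricted_perms i)
      (restricted_perms n)"
    unfolding bij_betw_def
  proof
    show "inj_on (\<lambda>(i, q). append_cycle i n q) (SIGMA i:{..<n}. restricted_perms i)"
      by (auto simp: inj_on_def dest: append_cycle_inj)
    show "(\<lambda>(i, q). append_cycle i n q) ` (SIGMA i:{..<n}. restricted_perms i) = restricted_perms n"
    proof (intro equalityI subsetI)
      fix p assume "p \<in> restricted_perms n"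
      then obtain i q where "i < n" "q \<in> restricted_perms i" "p = append_cycle i n q"
        using restricted_perm_eq_append_cycle assms(1) by blast
      then show "p \<in> (\<lambda>(i, q). append_cycle i n q) ` (SIGMA i:{..<n}. restricted_perms i)"
        by force
    qed (auto simp: append_cycle_in_restricted_perms)
  qed
  have "cycle_gf k n u = (\<Sum>(i, q)\<in>(SIGMA i:{..<n}. restricted_perms i).
      u ^ num_cycles n k (append_cycle i n q))"
    unfolding cycle_gf_def
    by (subst sum.reindex_bij_betw[OF bij, symmetric]) (simp add: case_prod_unfold)
  also have "\<dots> = (\<Sum>i<n. \<Sum>q\<in>restricted_perms i. u ^ num_cycles n k (append_cycle i n q))"
    by (rule sum.Sigma[symmetric]) (auto simp: finite_restricted_perms)
  also have "\<dots> = (\<Sum>i<n. (if n - i = k then u else 1) * cycle_gf k i u)"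
    unfolding cycle_gf_def sum_distrib_left
    by (intro sum.cong refl) (use assms in \<open>auto simp: num_cycles_append_cycle\<close>)
  finally show ?thesis .
qed

lemma cycle_gf_sum:
  assumes "n \<ge> k" "k \<ge> 1"
  shows "cycle_gf k n u = (\<Sum>i<n. cycle_gf k i u) + (u - 1) * cycle_gf k (n - k) u"
proof -
  have "cycle_gf k n u = (\<Sum>i<n. cycle_gf k i u + (if i = n - k then (u - 1) * cycle_gf k i u else 0))"
    using assms by (subst cycle_gf_decompose) (auto intro!: sum.cong simp: algebra_simps)
  also have "\<dots> = (\<Sum>i<n. cycle_gf k i u) + (u - 1) * cycle_gf k (n - k) u"
    using assms by (simp add: sum.distrib)
  finally show ?thesis .
qed

text \<open>The sum over all shorter lengths is common to the decompositions for \<open>n\<close> and \<open>n - 1\<close>.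
  Eliminating it leaves a linear recurrence of the fixed order \<open>k + 1\<close>.\<close>
lemma cycle_gf_rec:
  assumes "n \<ge> Suc k" "k \<ge> 1"
  shows "cycle_gf k n u = 2 * cycle_gf k (n - 1) u
           + (u - 1) * (cycle_gf k (n - k) u - cycle_gf k (n - Suc k) u)"
proof -
  obtain m where n: "n = Suc m" using assms by (cases n) auto
  have "(\<Sum>i<m. cycle_gf k i u) = cycle_gf k m u - (u - 1) * cycle_gf k (m - k) u"
    using cycle_gf_sum[of k m u] assms n by simp
  note sum = this
  have "cycle_gf k n u
      = (\<Sum>i<m. cycle_gf k i u) + cycle_gf k m u + (u - 1) * cycle_gf k (n - k) u"
    using cycle_gf_sum[of k n u] assms n by simp
  then show ?thesis unfolding sum using n by (simp add: algebra_simps)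
qed

lemma restricted_perms_0: "restricted_perms 0 = {id}"
  by (auto simp: restricted_perms_def)

lemma cycle_gf_one: "cycle_gf k n 1 = of_nat (card (restricted_perms n))"
  by (simp add: cycle_gf_def)

text \<open>At \<open>u = 1\<close> the recurrence only doubles. It does not mention \<open>k\<close> then, so the proof takes
  \<open>k = 1\<close>.\<close>
lemma card_restricted_perms: "card (restricted_perms (Suc n)) = 2 ^ n"
proof (induction n)
  case 0
  have "cycle_gf 1 1 1 = cycle_gf 1 0 1" by (subst cycle_gf_decompose) auto
  then show ?case unfolding cycle_gf_one by (simp add: restricted_perms_0)
next
  case (Suc n)
  have "cycle_gf 1 (Suc (Suc n)) 1 = 2 * cycle_gf 1 (Suc n) 1"
    by (subst cycle_gf_rec) auto
  then have "of_nat (card (restricted_perms (Suc (Suc n)))) = (of_nat (2 * 2 ^ n) :: complex)"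
    unfolding cycle_gf_one Suc by simp
  then show ?case unfolding of_nat_eq_iff by simp
qed

text \<open>The asymptotic mean number of \<open>k\<close>-cycles per element. The lag coefficients \<open>2\<^sup>-\<^sup>k\<close> and
  \<open>2\<^sup>-\<^sup>k\<^sup>-\<^sup>1\<close> in the recurrence for probability generating functions are twice and once this
  number.\<close>
definition growth_mean :: "nat \<Rightarrow> real" where
  "growth_mean k = 1 / 2 ^ (k + 1)"

text \<open>For \<open>n \<ge> 1\<close> this is the probability generating function of the number of \<open>k\<close>-cycles. At
  \<open>n = 0\<close> the exponent \<open>n - 1\<close> is cut off and the value is \<open>1\<close> instead of \<open>2\<close>, so the
  recurrence below starts only when its largest lag still reaches an index \<open>\<ge> 1\<close>.\<close>
definition norm_gf :: "nat \<Rightarrow> nat \<Rightarrow> complex \<Rightarrow> complex" where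
  "norm_gf k n u = cycle_gf k n u / 2 ^ (n - 1)"

lemma norm_gf_rec:
  assumes "k \<ge> 1" "n \<ge> k + 2"
  shows "norm_gf k n u - norm_gf k (n - 1) u =
    (u - 1) * (2 * of_real (growth_mean k) * norm_gf k (n - k) u
                 - of_real (growth_mean k) * norm_gf k (n - Suc k) u)"
proof -
  obtain m where n: "n = m + k + 2" using assms(2) by (metis add.commute add.left_commute le_Suc_ex)
  have "cycle_gf k n u = 2 * cycle_gf k (n - 1) u
           + (u - 1) * (cycle_gf k (n - k) u - cycle_gf k (n - Suc k) u)"
    using assms by (intro cycle_gf_rec) auto
  then show ?thesis unfolding norm_gf_def growth_mean_def n
    by (simp add: power_add field_simps)
qed

lemma norm_gf_at_1: "n \<ge> 1 \<Longrightarrow> norm_gf k n 1 = 1"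
  by (cases n) (auto simp: norm_gf_def cycle_gf_one card_restricted_perms)

lemma isCont_norm_gf: "isCont (norm_gf k n) u"
  unfolding norm_gf_def[abs_def] cycle_gf_def by (intro continuous_intros) auto

section \<open>Sequences with self-controlled increments\<close>

lemma telescoping_bound:
  fixes g :: "nat \<Rightarrow> 'a::real_normed_vector"
  assumes "1 \<le> n" "n \<le> N"
  shows "norm (g n - g 1) \<le> (\<Sum>j=2..N. norm (g j - g (j - 1)))"
proof -
  have "norm (g n - g 1) \<le> (\<Sum>j=2..n. norm (g j - g (j - 1)))"
    using assms(1)
  proof (induction n rule: dec_induct)
    case (step n)
    have "g (Suc n) - g 1 = (g n - g 1) + (g (Suc n) - g n)" by simp
    then have "norm (g (Suc n) - g 1) \<le> norm (g n - g 1) + norm (g (Suc n) - g n)"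
      by (metis norm_triangle_ineq)
    moreover have "(\<Sum>j=2..Suc n. norm (g j - g (j - 1)))
        = (\<Sum>j=2..n. norm (g j - g (j - 1))) + norm (g (Suc n) - g n)"
      using step(1) by simp
    ultimately show ?case using step.IH by linarith
  qed simp
  also have "\<dots> \<le> (\<Sum>j=2..N. norm (g j - g (j - 1)))"
    using assms(2) by (intro sum_mono2) auto
  finally show ?thesis .
qed

text \<open>Let \<open>S\<close> be the total variation of \<open>g\<close> on \<open>{1..N}\<close>. Summing the assumption over \<open>n\<close> counts
  each increment at most \<open>k + 1\<close> times, so \<open>S\<close> is at most the initial variation plus
  \<open>(\<delta> (k + 1) + \<rho> N) S + \<rho> N \<parallel>g 1\<parallel>\<close>. The smallness condition lets half of \<open>S\<close> absorb the
  \<open>S\<close> on the right. That \<open>\<delta>\<close> need not be small compared with \<open>1 / N\<close> is the point: only the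
  defect \<open>\<rho>\<close> accumulates over \<open>N\<close> steps.\<close>
lemma small_increments_recurrence:
  fixes g :: "nat \<Rightarrow> 'a::real_normed_vector"
  assumes rec: "\<And>n. k + 2 \<le> n \<Longrightarrow> n \<le> N \<Longrightarrow>
      norm (g n - g (n - 1)) \<le> \<delta> * (\<Sum>i\<le>k. norm (g (n - i) - g (n - i - 1))) + \<rho> * norm (g n)"
    and nonneg: "\<delta> \<ge> 0" "\<rho> \<ge> 0"
    and small: "\<delta> * (k + 1) + \<rho> * N \<le> 1 / 2"
    and "1 \<le> N"
  shows "norm (g N - g 1) \<le>
      2 * ((\<Sum>j=2..k+1. norm (g j - g (j - 1))) + \<rho> * N * norm (g 1))"
proof -
  define d where "d j = norm (g j - g (j - 1))" for j
  define S where "S = (\<Sum>j=2..N. d j)"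
  define S0 where "S0 = (\<Sum>j=2..k+1. d j)"
  have d_nonneg: "d j \<ge> 0" for j by (simp add: d_def)
  have S_nonneg: "S \<ge> 0" unfolding S_def by (intro sum_nonneg d_nonneg)
  have diff: "norm (g n - g 1) \<le> S" if "1 \<le> n" "n \<le> N" for n
    unfolding S_def d_def using that by (rule telescoping_bound)
  have size: "norm (g n) \<le> norm (g 1) + S" if "1 \<le> n" "n \<le> N" for n
    using diff[OF that] norm_triangle_sub[of "g n" "g 1"] by linarith
  define r where "r = \<rho> * (norm (g 1) + S)"
  have r_nonneg: "r \<ge> 0" using nonneg S_nonneg by (simp add: r_def)
  have window: "(\<Sum>n=k+2..N. d (n - i)) \<le> S" if "i \<le> k" for i
  proof -
    have "(\<Sum>n=k+2..N. d (n - i)) = (\<Sum>j\<in>(\<lambda>n. n - i) ` {k+2..N}. d j)"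
      using that by (subst sum.reindex) (auto simp: inj_on_def)
    also have "\<dots> \<le> S" unfolding S_def
      using that by (intro sum_mono2) (auto simp: d_nonneg)
    finally show ?thesis .
  qed
  have "S \<le> (\<Sum>j\<in>{2..k+1} \<union> {k+2..N}. d j)"
    unfolding S_def by (intro sum_mono2) (auto simp: d_nonneg)
  also have "\<dots> = S0 + (\<Sum>n=k+2..N. d n)"
    unfolding S0_def by (rule sum.union_disjoint) auto
  also have "(\<Sum>n=k+2..N. d n) \<le> (\<Sum>n=k+2..N. \<delta> * (\<Sum>i\<le>k. d (n - i)) + r)"
  proof (rule sum_mono)
    fix n assume n: "n \<in> {k+2..N}"
    have "d n \<le> \<delta> * (\<Sum>i\<le>k. d (n - i)) + \<rho> * norm (g n)"
      unfolding d_def using rec[of n] n by simp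
    also have "\<rho> * norm (g n) \<le> r"
      unfolding r_def using size[of n] n nonneg by (intro mult_left_mono) auto
    finally show "d n \<le> \<delta> * (\<Sum>i\<le>k. d (n - i)) + r" by (simp add: r_def)
  qed
  also have "\<dots> = \<delta> * (\<Sum>i\<le>k. \<Sum>n=k+2..N. d (n - i)) + real (card {k+2..N}) * r"
    unfolding sum.distrib sum_distrib_left[symmetric] by (subst sum.swap) simp
  also have "\<dots> \<le> \<delta> * (\<Sum>i\<le>k. S) + real N * r"
    using nonneg S_nonneg window r_nonneg
    by (intro add_mono mult_left_mono mult_right_mono sum_mono) auto
  finally have "S \<le> S0 + (\<delta> * (k + 1) + \<rho> * N) * S + \<rho> * N * norm (g 1)"
    by (simp add: r_def algebra_simps)
  moreover have "(\<delta> * (k + 1) + \<rho> * N) * S \<le> 1 / 2 * S"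
    using small S_nonneg by (rule mult_right_mono)
  ultimately have "S \<le> 2 * (S0 + \<rho> * N * norm (g 1))" by simp
  with diff[of N] \<open>1 \<le> N\<close> show ?thesis unfolding S0_def d_def by simp
qed

section \<open>The perturbed dominant root\<close>

lemma exp_second_order: "((\<lambda>w::complex. (exp w - 1 - w) / w\<^sup>2) \<longlongrightarrow> 1 / 2) (at 0)"
proof (rule Lim_null[THEN iffD2], rule Lim_null_comparison)
  show "\<forall>\<^sub>F w in at 0. norm ((exp w - 1 - w) / w\<^sup>2 - 1 / 2) \<le> exp \<bar>Re w\<bar> * norm w"
  proof (rule eventually_at_filter[THEN iffD2], rule always_eventually, intro allI impI)
    fix w :: complex assume "w \<noteq> 0"
    have "norm (exp w - (\<Sum>i\<le>2. w ^ i / fact i)) \<le> exp \<bar>Re w\<bar> * norm w ^ Suc 2 / fact 2"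
      by (rule Taylor_exp)
    also have "\<dots> \<le> exp \<bar>Re w\<bar> * norm w ^ Suc 2 / 1"
      by (intro divide_left_mono) auto
    also have "(\<Sum>i\<le>2. w ^ i / fact i) = 1 + w + w\<^sup>2 / 2"
      by (simp add: numeral_2_eq_2)
    finally have "norm (exp w - (1 + w + w\<^sup>2 / 2)) \<le> exp \<bar>Re w\<bar> * norm w * norm w ^ 2"
      by (simp add: power2_eq_square power3_eq_cube mult_ac)
    moreover have "(exp w - 1 - w) / w\<^sup>2 - 1 / 2 = (exp w - (1 + w + w\<^sup>2 / 2)) / w\<^sup>2"
      using \<open>w \<noteq> 0\<close> by (simp add: field_simps)
    ultimately show "norm ((exp w - 1 - w) / w\<^sup>2 - 1 / 2) \<le> exp \<bar>Re w\<bar> * norm w"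
      using \<open>w \<noteq> 0\<close> by (simp add: norm_divide norm_power pos_divide_le_eq)
  qed
  have "((\<lambda>w. exp \<bar>Re w\<bar> * norm w) \<longlongrightarrow> exp \<bar>Re 0\<bar> * norm (0::complex)) (at 0)"
    by (intro tendsto_intros)
  then show "((\<lambda>w::complex. exp \<bar>Re w\<bar> * norm w) \<longlongrightarrow> 0) (at 0)" by simp
qed

text \<open>The inner expression \<open>a z + b z\<^sup>2\<close> may vanish for \<open>z \<noteq> 0\<close>, so the quotient of the previous lemma
  is extended continuously to \<open>0\<close> before it is composed.\<close>
lemma exp_quadratic_second_order:
  fixes a b :: complex
  shows "((\<lambda>z. (exp (a * z + b * z\<^sup>2) - 1 - a * z) / z\<^sup>2) \<longlongrightarrow> b + a\<^sup>2 / 2) (at 0)"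
proof -
  define h :: "complex \<Rightarrow> complex" where "h w = (if w = 0 then 1 / 2 else (exp w - 1 - w) / w\<^sup>2)" for w
  have h: "exp w = 1 + w + w\<^sup>2 * h w" for w by (simp add: h_def)
  have "(h \<longlongrightarrow> 1 / 2) (at 0)"
    by (rule Lim_transform_eventually[OF exp_second_order])
      (auto simp: h_def eventually_at_filter)
  then have "isCont h 0" by (simp add: isCont_def h_def)
  moreover have "((\<lambda>z. a * z + b * z\<^sup>2) \<longlongrightarrow> a * 0 + b * 0\<^sup>2) (at 0)" by (intro tendsto_intros)
  ultimately have "((\<lambda>z. h (a * z + b * z\<^sup>2)) \<longlongrightarrow> h 0) (at 0)"
    by (intro isCont_tendsto_compose[of 0 h]) auto
  then have "((\<lambda>z. b + (a + b * z)\<^sup>2 * h (a * z + b * z\<^sup>2)) \<longlongrightarrow> b + (a + b * 0)\<^sup>2 * h 0) (at 0)"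
    by (intro tendsto_intros)
  moreover have "b + (a + b * z)\<^sup>2 * h (a * z + b * z\<^sup>2)
      = (exp (a * z + b * z\<^sup>2) - 1 - a * z) / z\<^sup>2" if "z \<noteq> 0" for z
  proof -
    have "(a * z + b * z\<^sup>2)\<^sup>2 = z\<^sup>2 * (a + b * z)\<^sup>2" by (simp add: power2_eq_square algebra_simps)
    then show ?thesis unfolding h[of "a * z + b * z\<^sup>2"] using that by (simp add: field_simps)
  qed
  ultimately show ?thesis
    by (auto simp: h_def eventually_at_filter elim!: Lim_transform_eventually)
qed

text \<open>The coefficient of \<open>n\<close> in the variance. It is the solution of the equation that makes the
  terms of order \<open>z\<^sup>2\<close> cancel in the defect defined below.\<close>
definition growth_var :: "nat \<Rightarrow> real" where
  "growth_var k = growth_mean k + (3 - 2 * real k) * (growth_mean k)\<^sup>2"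

text \<open>A closed form for the dominant root of the characteristic equation, correct up to \<open>o(z\<^sup>2)\<close>.
  Being an exponential of a quadratic polynomial, its powers give a Gaussian characteristic function
  exactly, without a logarithm or an implicit function theorem.\<close>
definition growth :: "nat \<Rightarrow> complex \<Rightarrow> complex" where
  "growth k z = exp (of_real (growth_mean k) * z + of_real (growth_var k / 2) * z\<^sup>2)"

text \<open>The error that \<open>growth k z\<close> leaves in the characteristic equation of the recurrence at
  \<open>u = exp z\<close>.\<close>
definition char_defect :: "nat \<Rightarrow> complex \<Rightarrow> complex" where
  "char_defect k z = growth k z ^ (k + 1) - growth k z ^ k
     - (exp z - 1) * (2 * of_real (growth_mean k) * growth k z - of_real (growth_mean k))"

text \<open>The defect is a linear combination of exponentials \<open>exp (p z + q z\<^sup>2)\<close>, so its second-order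
  expansion follows term by term; the coefficients of \<open>1\<close>, \<open>z\<close> and \<open>z\<^sup>2\<close> all vanish.\<close>
lemma char_defect_small: "((\<lambda>z. char_defect k z / z\<^sup>2) \<longlongrightarrow> 0) (at 0)"
proof -
  define a where "a = complex_of_real (growth_mean k)"
  define b where "b = complex_of_real (growth_var k / 2)"
  have b: "2 * b = a + (3 - 2 * of_nat k) * a\<^sup>2"
    by (simp add: b_def a_def growth_var_def)
  define E where "E p q z = (exp (p * z + q * z\<^sup>2) - 1 - p * z) / z\<^sup>2" for p q z :: complex
  have E: "(E p q \<longlongrightarrow> q + p\<^sup>2 / 2) (at 0)" for p q
    unfolding E_def by (rule exp_quadratic_second_order)
  let ?k = "of_nat k :: complex"
  have "((\<lambda>z. E ((?k + 1) * a) ((?k + 1) * b) z - E (?k * a) (?k * b) z - 2 * a * E (a + 1) b z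
        + a * E 1 0 z + 2 * a * E a b z) \<longlongrightarrow>
      ((?k + 1) * b + ((?k + 1) * a)\<^sup>2 / 2) - (?k * b + (?k * a)\<^sup>2 / 2) - 2 * a * (b + (a + 1)\<^sup>2 / 2)
        + a * (0 + 1\<^sup>2 / 2) + 2 * a * (b + a\<^sup>2 / 2)) (at 0)" (is "(?f \<longlongrightarrow> ?L) _")
    by (intro tendsto_intros E)
  also have "?L = (2 * b - (a + (3 - 2 * of_nat k) * a\<^sup>2)) / 2"
    by (simp add: field_simps power2_eq_square)
  also have "\<dots> = 0" by (simp add: b)
  finally have lim: "(?f \<longlongrightarrow> 0) (at 0)" .
  have "?f z = char_defect k z / z\<^sup>2" if "z \<noteq> 0" for z
  proof -
    have gz: "growth k z = exp (a * z + b * z\<^sup>2)" by (simp add: growth_def a_def b_def)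
    have pow: "growth k z ^ j = exp (of_nat j * a * z + of_nat j * b * z\<^sup>2)" for j
      unfolding gz exp_of_nat_mult[symmetric] by (simp add: algebra_simps)
    have prod: "exp z * growth k z = exp ((a + 1) * z + b * z\<^sup>2)"
      unfolding gz exp_add[symmetric] by (simp add: algebra_simps)
    have "char_defect k z = exp ((?k + 1) * a * z + (?k + 1) * b * z\<^sup>2)
        - exp (?k * a * z + ?k * b * z\<^sup>2) - 2 * a * exp ((a + 1) * z + b * z\<^sup>2)
        + a * exp (1 * z + 0 * z\<^sup>2) + 2 * a * exp (a * z + b * z\<^sup>2) - a"
      unfolding char_defect_def pow prod[symmetric] gz[symmetric] a_def[symmetric]
      by (simp add: algebra_simps)
    also have "\<dots> = ?f z * z\<^sup>2"
      unfolding E_def using that by (simp add: field_simps power2_eq_square)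
    finally show ?thesis using that by simp
  qed
  then show ?thesis
    by (intro Lim_transform_eventually[OF lim]) (auto simp: eventually_at_filter)
qed

section \<open>Asymptotics of the generating function\<close>

text \<open>Divide \<open>norm_gf k j (exp (z n))\<close> by the \<open>j\<close>-th power of the approximate root to get \<open>g n j\<close>.
  In terms of \<open>g n\<close> the recurrence says that an increment is a combination of the last
  \<open>k + 1\<close> increments, itself included, with coefficients of order \<open>exp (z n) - 1\<close>, plus the defect times \<open>g n j\<close>.
  The defect is \<open>o((z n)\<^sup>2) = o(1/n)\<close>, so the variation of \<open>g n\<close> up to index \<open>n\<close> vanishes in
  the limit, and \<open>g n n\<close> has the limit of the initial value \<open>g n 1\<close>.\<close>
lemma norm_gf_asymptotics:
  fixes z :: "nat \<Rightarrow> complex"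
  assumes k: "k \<ge> 1" and z: "z \<longlonglongrightarrow> 0" and nz: "(\<lambda>n. of_nat n * (z n)\<^sup>2) \<longlonglongrightarrow> c"
  shows "(\<lambda>n. norm_gf k n (exp (z n)) / growth k (z n) ^ n) \<longlonglongrightarrow> 1"
proof -
  define a where "a = complex_of_real (growth_mean k)"
  define L where "L n = growth k (z n)" for n
  define g where "g n j = norm_gf k j (exp (z n)) / L n ^ j" for n j
  define e where "e n = exp (z n) - 1" for n
  define \<delta> where "\<delta> n = norm (e n) * (norm (2 * a * L n) + norm a) / norm (L n) ^ k" for n
  define \<rho> where "\<rho> n = norm (char_defect k (z n)) / norm (L n) ^ k" for n
  have L_nz: "L n \<noteq> 0" for n by (simp add: L_def growth_def)
  have "(\<lambda>n. exp (of_real (growth_mean k) * z n + of_real (growth_var k / 2) * (z n)\<^sup>2))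
      \<longlonglongrightarrow> exp (of_real (growth_mean k) * 0 + of_real (growth_var k / 2) * 0\<^sup>2)"
    by (intro tendsto_intros z)
  then have L_lim: "L \<longlonglongrightarrow> 1" by (simp add: L_def[abs_def] growth_def)
  have exp_lim: "(\<lambda>n. exp (z n)) \<longlonglongrightarrow> 1" using tendsto_exp[OF z] by simp
  then have e_lim: "e \<longlonglongrightarrow> 0" unfolding e_def[abs_def] by (rule LIM_zero)

  have g_lim: "(\<lambda>n. g n j) \<longlonglongrightarrow> 1" if "j \<ge> 1" for j
  proof -
    have "(\<lambda>n. norm_gf k j (exp (z n))) \<longlonglongrightarrow> norm_gf k j 1"
      by (rule isCont_tendsto_compose[OF isCont_norm_gf exp_lim])
    then have "(\<lambda>n. g n j) \<longlonglongrightarrow> norm_gf k j 1 / 1 ^ j"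
      unfolding g_def by (intro tendsto_intros L_lim) auto
    then show ?thesis using norm_gf_at_1[OF that] by simp
  qed

  have "\<delta> \<longlonglongrightarrow> norm (0::complex) * (norm (2 * a * 1) + norm a) / norm (1::complex) ^ k"
    unfolding \<delta>_def[abs_def] by (intro tendsto_intros e_lim L_lim) auto
  then have \<delta>_lim: "\<delta> \<longlonglongrightarrow> 0" by simp

  have defect_0: "char_defect k 0 = 0" by (simp add: char_defect_def growth_def)
  \<comment> \<open>At 0 the quotient has the value 0 by the convention for division, which is its limit;
    so the case z n = 0 is covered by continuity.\<close>
  have "isCont (\<lambda>z. char_defect k z / z\<^sup>2) 0"
    using char_defect_small by (simp add: isCont_def)
  from isCont_tendsto_compose[OF this z]
  have "(\<lambda>n. char_defect k (z n) / (z n)\<^sup>2) \<longlonglongrightarrow> 0" by simp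
  from tendsto_mult[OF this nz]
  have "(\<lambda>n. char_defect k (z n) / (z n)\<^sup>2 * (of_nat n * (z n)\<^sup>2)) \<longlonglongrightarrow> 0" by simp
  moreover have "char_defect k (z n) / (z n)\<^sup>2 * (of_nat n * (z n)\<^sup>2)
      = char_defect k (z n) * of_nat n" for n
    using defect_0 by (cases "z n = 0") auto
  ultimately have "(\<lambda>n. char_defect k (z n) * of_nat n) \<longlonglongrightarrow> 0" by simp
  then have "(\<lambda>n. norm (char_defect k (z n) * of_nat n) / norm (L n) ^ k)
      \<longlonglongrightarrow> norm (0::complex) / norm (1::complex) ^ k"
    by (intro tendsto_intros L_lim) auto
  then have \<rho>_lim: "(\<lambda>n. \<rho> n * real n) \<longlonglongrightarrow> 0"
    unfolding \<rho>_def by (simp add: norm_mult)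

  have rec: "norm (g n j - g n (j - 1))
      \<le> \<delta> n * (\<Sum>i\<le>k. norm (g n (j - i) - g n (j - i - 1))) + \<rho> n * norm (g n j)"
    if j: "k + 2 \<le> j" for n j
  proof -
    define T where "T = (\<Sum>i\<le>k. norm (g n (j - i) - g n (j - i - 1)))"
    \<comment> \<open>Both lags are telescoped back to index j, so that only differences remain.\<close>
    have lag: "norm (g n (j - m) - g n j) \<le> T" if "m \<le> Suc k" for m
    proof -
      have "g n j - g n (j - m) = (\<Sum>i<m. g n (j - i) - g n (j - Suc i))"
        by (induction m) (auto simp: algebra_simps)
      then have "norm (g n (j - m) - g n j) \<le> (\<Sum>i<m. norm (g n (j - i) - g n (j - i - 1)))"
        by (simp add: norm_minus_commute norm_sum)
      also have "\<dots> \<le> T" unfolding T_def using that by (intro sum_mono2) auto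
      finally show ?thesis .
    qed
    obtain m where m: "j = m + k + 1" using j by (metis Suc_eq_plus1 add_2_eq_Suc' add.commute le_Suc_ex add_Suc)
    have nf: "norm_gf k i (exp (z n)) = g n i * L n ^ i" for i
      using L_nz[of n] by (simp add: g_def)
    have "g n j * L n ^ j - g n (j - 1) * L n ^ (j - 1)
       = e n * (2 * a * (g n (j - k) * L n ^ (j - k)) - a * (g n (j - Suc k) * L n ^ (j - Suc k)))"
      using norm_gf_rec[OF k j, of "exp (z n)"] unfolding nf e_def a_def .
    then have "L n ^ m * (g n j * L n ^ (k + 1) - g n (j - 1) * L n ^ k)
       = L n ^ m * (e n * (2 * a * g n (j - k) * L n - a * g n (j - Suc k)))"
      by (simp add: m power_add algebra_simps)
    then have step: "g n j * L n ^ (k + 1) - g n (j - 1) * L n ^ k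
       = e n * (2 * a * g n (j - k) * L n - a * g n (j - Suc k))"
      using L_nz[of n] by simp
    have defect: "char_defect k (z n) = L n ^ (k + 1) - L n ^ k - e n * (2 * a * L n - a)"
      by (simp add: char_defect_def L_def e_def a_def)
    have "L n ^ k * (g n j - g n (j - 1))
       = (g n j * L n ^ (k + 1) - g n (j - 1) * L n ^ k) - g n j * (L n ^ (k + 1) - L n ^ k)"
      by (simp add: algebra_simps)
    also have "\<dots> = e n * (2 * a * L n * (g n (j - k) - g n j) - a * (g n (j - Suc k) - g n j))
           - char_defect k (z n) * g n j"
      unfolding step defect by (simp add: algebra_simps)
    finally have "norm (L n ^ k * (g n j - g n (j - 1)))
       \<le> norm (e n * (2 * a * L n * (g n (j - k) - g n j) - a * (g n (j - Suc k) - g n j)))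
           + norm (char_defect k (z n) * g n j)"
      using norm_triangle_ineq4 by metis
    also have "\<dots> \<le> norm (e n) * (norm (2 * a * L n) * T + norm a * T)
           + norm (char_defect k (z n)) * norm (g n j)"
    proof -
      have "norm (2 * a * L n * (g n (j - k) - g n j) - a * (g n (j - Suc k) - g n j))
         \<le> norm (2 * a * L n * (g n (j - k) - g n j)) + norm (a * (g n (j - Suc k) - g n j))"
        by (rule norm_triangle_ineq4)
      also have "\<dots> \<le> norm (2 * a * L n) * T + norm a * T"
        unfolding norm_mult[of "2 * a * L n"] norm_mult[of a "_ - _"]
        by (intro add_mono mult_left_mono lag) auto
      finally show ?thesis
        unfolding norm_mult[of "e n"] norm_mult[of "char_defect k (z n)"]
        by (intro add_mono mult_left_mono) auto
    qed
    finally have "norm (L n) ^ k * norm (g n j - g n (j - 1))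
        \<le> norm (e n) * (norm (2 * a * L n) + norm a) * T + norm (char_defect k (z n)) * norm (g n j)"
      by (simp only: norm_mult[of "L n ^ k"] norm_mult[of "char_defect k (z n)"] norm_power
          distrib_right mult.assoc)
    then have "norm (g n j - g n (j - 1)) \<le> (norm (e n) * (norm (2 * a * L n) + norm a) * T
        + norm (char_defect k (z n)) * norm (g n j)) / norm (L n) ^ k"
      using L_nz[of n] by (simp add: pos_le_divide_eq mult.commute)
    then show ?thesis unfolding \<delta>_def \<rho>_def T_def[symmetric] by (simp add: add_divide_distrib)
  qed

  define B where "B n = 2 * ((\<Sum>j=2..k+1. norm (g n j - g n (j - 1))) + \<rho> n * real n * norm (g n 1))" for n
  have "B \<longlonglongrightarrow> 2 * ((\<Sum>j=2..k+1. norm (1 - 1 :: complex)) + 0 * norm (1 :: complex))"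
    unfolding B_def[abs_def] by (intro tendsto_intros g_lim \<rho>_lim) auto
  then have B_lim: "B \<longlonglongrightarrow> 0" by simp
  have "(\<lambda>n. \<delta> n * real (k + 1) + \<rho> n * real n) \<longlonglongrightarrow> 0 * real (k + 1) + 0"
    by (intro tendsto_intros \<delta>_lim \<rho>_lim)
  then have "\<forall>\<^sub>F n in sequentially. \<delta> n * real (k + 1) + \<rho> n * real n < 1 / 2"
    by (rule order_tendstoD) simp
  then have "\<forall>\<^sub>F n in sequentially. norm (g n n - g n 1) \<le> B n"
    using eventually_ge_at_top[of 1]
  proof eventually_elim
    case (elim n)
    show ?case unfolding B_def
      by (rule small_increments_recurrence[where \<delta> = "\<delta> n"])
        (use elim rec in \<open>auto simp: \<delta>_def \<rho>_def\<close>)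
  qed
  then have "(\<lambda>n. g n n - g n 1) \<longlonglongrightarrow> 0"
    using B_lim by (rule Lim_null_comparison)
  from tendsto_add[OF this g_lim[of 1]] show ?thesis by (simp add: g_def L_def)
qed

section \<open>The central limit theorem\<close>

lemma growth_var_pos:
  assumes "k \<ge> 1" shows "growth_var k > 0"
proof -
  have "2 * real k < 2 ^ (k + 1) + 3"
    using of_nat_less_two_power[of k, where 'a = real] unfolding power_add power_one_right by linarith
  moreover have "growth_var k = (2 ^ (k + 1) + 3 - 2 * real k) * (growth_mean k)\<^sup>2"
    by (simp add: growth_var_def growth_mean_def field_simps power2_eq_square)
  ultimately show ?thesis by (simp add: growth_mean_def)
qed

lemma sigma_cyc_sq_affine:
  "sigma_cyc_sq n k = growth_var k * real n
     + (3 * real k * (real k - 4) + (3 - real k) * 2 ^ (k + 1) + 5) / 4 ^ (k + 1)"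
proof -
  have 4: "(4::real) ^ (k + 1) = (2 ^ (k + 1))\<^sup>2"
    by (simp flip: power_mult_distrib add: power2_eq_square)
  have var: "growth_var k = (2 ^ (k + 1) - 2 * real k + 3) / 4 ^ (k + 1)"
    unfolding 4 growth_var_def growth_mean_def by (simp add: field_simps power2_eq_square)
  show ?thesis
    unfolding var by (simp add: sigma_cyc_sq_def add_divide_distrib diff_divide_distrib algebra_simps)
qed

lemma mu_cyc_eq: "mu_cyc n k = growth_mean k * real n - growth_mean k * (real k - 3)"
  by (simp add: mu_cyc_def growth_mean_def field_simps)

lemma sigma_cyc_asymp:
  assumes "k \<ge> 1"
  shows "(\<lambda>n. real n / sigma_cyc_sq n k) \<longlonglongrightarrow> 1 / growth_var k"
    and "filterlim (\<lambda>n. sigma_cyc n k) at_top sequentially"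
proof -
  define c where "c = (3 * real k * (real k - 4) + (3 - real k) * 2 ^ (k + 1) + 5) / 4 ^ (k + 1)"
  have s: "sigma_cyc_sq n k = growth_var k * real n + c" for n
    unfolding c_def by (rule sigma_cyc_sq_affine)
  have v: "growth_var k > 0" using assms by (rule growth_var_pos)
  then have "(\<lambda>n. real n / sigma_cyc_sq n k) \<longlonglongrightarrow> inverse (growth_var k)"
    unfolding s by real_asymp
  then show "(\<lambda>n. real n / sigma_cyc_sq n k) \<longlonglongrightarrow> 1 / growth_var k"
    by (simp add: inverse_eq_divide)
  show "filterlim (\<lambda>n. sigma_cyc n k) at_top sequentially"
    unfolding sigma_cyc_def s using v by real_asymp
qed

definition standardized_cycles :: "nat \<Rightarrow> nat \<Rightarrow> (nat \<Rightarrow> nat) \<Rightarrow> real" where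
  "standardized_cycles n k p = (real (num_cycles n k p) - mu_cyc n k) / sigma_cyc n k"

definition cycle_distr :: "nat \<Rightarrow> nat \<Rightarrow> real measure" where
  "cycle_distr n k =
     distr (measure_pmf (pmf_of_set (restricted_perms n))) borel (standardized_cycles n k)"

lemma real_distribution_cycle_distr: "real_distribution (cycle_distr n k)"
  unfolding cycle_distr_def
  by (rule prob_space.real_distribution_distr) (auto intro: measure_pmf.prob_space_axioms)

lemma char_cycle_distr:
  fixes n k :: nat and t :: real
  assumes "n \<ge> 1"
  defines "z \<equiv> \<i> * of_real (t / sigma_cyc n k)"
  shows "char (cycle_distr n k) t = exp (- z * of_real (mu_cyc n k)) * norm_gf k n (exp z)"
proof -
  have card: "card (restricted_perms n) = 2 ^ (n - 1)"
    using assms(1) card_restricted_perms[of "n - 1"] by simp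
  have "char (cycle_distr n k) t
      = (CLINT p|measure_pmf (pmf_of_set (restricted_perms n)). iexp (t * standardized_cycles n k p))"
    unfolding char_def cycle_distr_def by (subst integral_distr) auto
  also have "\<dots> = (\<Sum>p\<in>restricted_perms n. iexp (t * standardized_cycles n k p) / 2 ^ (n - 1))"
    using restricted_perms_nonempty[of n] finite_restricted_perms[of n]
    by (subst integral_measure_pmf[of "restricted_perms n"])
      (auto simp: card scaleR_conv_of_real intro!: sum.cong)
  also have "\<dots> = (\<Sum>p\<in>restricted_perms n.
      exp (- z * of_real (mu_cyc n k)) * (exp z ^ num_cycles n k p / 2 ^ (n - 1)))"
  proof (rule sum.cong[OF refl])
    fix p
    have "\<i> * of_real (t * standardized_cycles n k p)
        = - z * of_real (mu_cyc n k) + of_nat (num_cycles n k p) * z"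
      by (simp add: standardized_cycles_def z_def diff_divide_distrib algebra_simps)
    then show "iexp (t * standardized_cycles n k p) / 2 ^ (n - 1)
        = exp (- z * of_real (mu_cyc n k)) * (exp z ^ num_cycles n k p / 2 ^ (n - 1))"
      by (simp only: exp_add exp_of_nat_mult times_divide_eq_right)
  qed
  also have "\<dots> = exp (- z * of_real (mu_cyc n k)) * norm_gf k n (exp z)"
    by (simp add: norm_gf_def cycle_gf_def sum_distrib_left sum_divide_distrib)
  finally show ?thesis .
qed

text \<open>At \<open>z = \<i> t / \<sigma>\<close> the linear term of the exponent of the \<open>n\<close>-th power of \<open>growth\<close> cancels
  against the centering up to a constant times \<open>z \<longlonglongrightarrow> 0\<close>. The quadratic term tends to
  \<open>- t\<^sup>2 / 2\<close>, because \<open>n z\<^sup>2 = - t\<^sup>2 n / \<sigma>\<^sup>2\<close> and the variance grows like \<open>growth_var k\<close>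
  times \<open>n\<close>.\<close>
lemma char_cycle_distr_tendsto:
  assumes k: "k \<ge> 1"
  shows "(\<lambda>n. char (cycle_distr n k) t) \<longlonglongrightarrow> char std_normal_distribution t"
proof -
  define z where "z n = \<i> * complex_of_real (t / sigma_cyc n k)" for n
  define a where "a = complex_of_real (growth_mean k)"
  define b where "b = complex_of_real (growth_var k)"
  have b_nz: "b \<noteq> 0" using growth_var_pos[OF k] by (simp add: b_def)
  have "(\<lambda>n. t / sigma_cyc n k) \<longlonglongrightarrow> 0"
    by (intro tendsto_divide_0[OF tendsto_const] filterlim_at_top_imp_at_infinity sigma_cyc_asymp k)
  then have "z \<longlonglongrightarrow> \<i> * of_real 0"
    unfolding z_def[abs_def] by (intro tendsto_intros)
  then have z: "z \<longlonglongrightarrow> 0" by simp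
  have "(\<lambda>n. - (of_real t)\<^sup>2 * complex_of_real (real n / sigma_cyc_sq n k))
      \<longlonglongrightarrow> - (of_real t)\<^sup>2 * of_real (1 / growth_var k)"
    by (intro tendsto_intros sigma_cyc_asymp k)
  moreover have "\<forall>\<^sub>F n in sequentially.
      - (of_real t)\<^sup>2 * complex_of_real (real n / sigma_cyc_sq n k) = of_nat n * (z n)\<^sup>2"
    using filterlim_at_top_dense[THEN iffD1, OF sigma_cyc_asymp(2)[OF k], rule_format, of 0]
  proof eventually_elim
    case (elim n)
    then have "sigma_cyc_sq n k = (sigma_cyc n k)\<^sup>2" by (simp add: sigma_cyc_def)
    then show ?case by (simp add: z_def power_mult_distrib power_divide)
  qed
  ultimately have nz: "(\<lambda>n. of_nat n * (z n)\<^sup>2) \<longlonglongrightarrow> - (of_real t)\<^sup>2 / b"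
    by (auto simp: b_def intro: Lim_transform_eventually)

  have "(\<lambda>n. exp (a * of_real (real k - 3) * z n + b / 2 * (of_nat n * (z n)\<^sup>2))
        * (norm_gf k n (exp (z n)) / growth k (z n) ^ n))
      \<longlonglongrightarrow> exp (a * of_real (real k - 3) * 0 + b / 2 * (- (of_real t)\<^sup>2 / b)) * 1"
    by (intro tendsto_intros z nz norm_gf_asymptotics[OF k z nz]) auto
  also have "exp (a * of_real (real k - 3) * 0 + b / 2 * (- (of_real t)\<^sup>2 / b)) * 1
      = complex_of_real (exp (- t\<^sup>2 / 2))"
    using b_nz by (simp flip: exp_of_real)
  finally have lim: "(\<lambda>n. exp (a * of_real (real k - 3) * z n + b / 2 * (of_nat n * (z n)\<^sup>2))
        * (norm_gf k n (exp (z n)) / growth k (z n) ^ n)) \<longlonglongrightarrow> char std_normal_distribution t"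
    by (simp add: char_std_normal_distribution)
  show ?thesis
  proof (rule Lim_transform_eventually[OF lim])
    show "\<forall>\<^sub>F n in sequentially.
        exp (a * of_real (real k - 3) * z n + b / 2 * (of_nat n * (z n)\<^sup>2))
          * (norm_gf k n (exp (z n)) / growth k (z n) ^ n) = char (cycle_distr n k) t"
      using eventually_ge_at_top[of 1]
    proof eventually_elim
      case (elim n)
      have pow: "growth k (z n) ^ n = exp (of_nat n * (a * z n + b / 2 * (z n)\<^sup>2))"
        unfolding growth_def exp_of_nat_mult by (simp add: a_def b_def)
      have "a * of_real (real k - 3) * z n + b / 2 * (of_nat n * (z n)\<^sup>2)
          = - z n * of_real (mu_cyc n k) + of_nat n * (a * z n + b / 2 * (z n)\<^sup>2)"
        by (simp add: mu_cyc_eq a_def algebra_simps)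
      then have "exp (a * of_real (real k - 3) * z n + b / 2 * (of_nat n * (z n)\<^sup>2))
          = exp (- z n * of_real (mu_cyc n k)) * growth k (z n) ^ n"
        unfolding pow by (simp only: exp_add)
      moreover have "growth k (z n) \<noteq> 0" by (simp add: growth_def)
      ultimately show ?case
        using char_cycle_distr[OF elim, of k t] unfolding z_def[symmetric] by simp
    qed
  qed
qed

lemma std_normal_distribution_lessThan:
  "measure std_normal_distribution {..<t} = 1 / sqrt (2 * pi) * (LBINT x:{..t}. exp (- (x\<^sup>2) / 2))"
proof -
  have "measure std_normal_distribution {..<t} = measure std_normal_distribution {..t}"
  proof (rule measure_eq_AE)
    have "AE x in lborel. x \<noteq> t" by (rule AE_lborel_singleton)
    then show "AE x in std_normal_distribution. x \<in> {..<t} \<longleftrightarrow> x \<in> {..t}"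
      by (subst AE_density) (auto elim: eventually_mono)
  qed auto
  also have "\<dots> = (LINT x|std_normal_distribution. indicator {..t} x)" by simp
  also have "\<dots> = (LBINT x:{..t}. std_normal_density x)"
    by (subst integral_density) (auto simp: set_lebesgue_integral_def mult.commute)
  also have "\<dots> = 1 / sqrt (2 * pi) * (LBINT x:{..t}. exp (- (x\<^sup>2) / 2))"
    unfolding std_normal_density_def by (rule set_integral_mult_right)
  finally show ?thesis .
qed

theorem theorem1p1:
  fixes k :: nat and t :: real
  assumes "k \<ge> 1"
  shows "(\<lambda>n. measure_pmf.prob (pmf_of_set (restricted_perms n))
              {p. (real (num_cycles n k p) - mu_cyc n k) / sigma_cyc n k < t})
         \<longlonglongrightarrow> 1 / sqrt (2 * pi) * (LBINT x:{..t}. exp (- (x\<^sup>2) / 2))"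
proof -
  have weak: "weak_conv_m (\<lambda>n. cycle_distr n k) std_normal_distribution"
    by (intro levy_continuity real_distribution_cycle_distr real_dist_normal_dist
        char_cycle_distr_tendsto assms)
  \<comment> \<open>The limit law has no atoms, so half-lines, open or closed, are continuity sets.\<close>
  have "emeasure std_normal_distribution {t} = 0"
    by (subst emeasure_density) (auto simp: nn_integral_null_set AE_lborel_singleton)
  then have "emeasure std_normal_distribution (frontier {..<t}) = 0" by simp
  then have "(\<lambda>n. measure (cycle_distr n k) {..<t}) \<longlonglongrightarrow> measure std_normal_distribution {..<t}"
    by (intro weak_conv_imp_continuity_set_conv real_distribution_cycle_distr
        real_dist_normal_dist weak) auto
  moreover have "measure (cycle_distr n k) {..<t}
      = measure_pmf.prob (pmf_of_set (restricted_perms n))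
          {p. (real (num_cycles n k p) - mu_cyc n k) / sigma_cyc n k < t}" for n
    unfolding cycle_distr_def
    by (subst measure_distr) (auto simp: standardized_cycles_def vimage_def)
  ultimately show ?thesis by (simp add: std_normal_distribution_lessThan)
qed

end
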